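(* Let $f$, $c$, $F$ be as in the context, let $\theta_0\in\mathbb{R}^n$ and fix $\epsilon>0$. For $\eta>0$ let $\beta\in(0,1)$ be determined by $\epsilon=\frac{\beta\eta}{1-\beta}$, and let $U_k=(\theta_k,v_k,r_k)$ be generated by $$v_k=\beta v_{k-1}+(1-\beta)\nabla F(\theta_k),\quad v_{-1}=0,\qquad r_{k+1}=\frac{r_k}{1+2\eta|v_k|^2},\quad r_0=F(\theta_0),\qquad \theta_{k+1}=\theta_k-2\eta r_{k+1}v_k,\qquad k\ge 0.$$ Let $U(t)=(\theta(t),v(t),r(t))$ be the solution of $$\epsilon\dot v=-v+\nabla F(\theta),\qquad \dot r=-2r|v|^2,\qquad \dot\theta=-2rv,\qquad t>0,$$ with initial data $\theta(0)=\theta_0$, $v(0)=0$, $r(0)=F(\theta_0)$. Then for any $T>0$, $$\lim_{\substack{\eta\to 0\\ k\eta=T}}U_k=U(T).$$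
   Context: Standing assumptions: $f:\mathbb{R}^n\to\mathbb{R}$ is $C^2$, coercive ($\lim_{|\theta|\to\infty}f(\theta)=\infty$) and bounded from below; $c\in\mathbb{R}$ is chosen so that, with $f^*=\min f$, $F(\theta):=\sqrt{f(\theta)+c}\ge F^*:=\sqrt{f^*+c}>0$ for all $\theta\in\mathbb{R}^n$. $|\cdot|$ is the Euclidean norm. The limit is taken as $\eta\to 0$ along step sizes with $k=T/\eta$ a positive integer, keeping $\epsilon$ fixed (so $\beta=\epsilon/(\epsilon+\eta)$ varies with $\eta$). A dot denotes the derivative in $t$. *)

theory Defs
  imports "HOL-Analysis.Analysis"
begin

definition C2 :: "('a::real_normed_vector \<Rightarrow> real) \<Rightarrow> bool" where
  "C2 f \<longleftrightarrow>
    (\<exists>(f' :: 'a \<Rightarrow> 'a \<Rightarrow>\<^sub>L real) (f'' :: 'a \<Rightarrow> 'a \<Rightarrow>\<^sub>L ('a \<Rightarrow>\<^sub>L real)).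
      (\<forall>x. (f has_derivative blinfun_apply (f' x)) (at x)) \<and>
      (\<forall>x. (f' has_derivative blinfun_apply (f'' x)) (at x)) \<and>
      continuous_on UNIV f'')"

definition coercive :: "('a::real_normed_vector \<Rightarrow> real) \<Rightarrow> bool" where
  "coercive f \<longleftrightarrow> filterlim f at_top at_infinity"

(* Unspecified where f is not differentiable. *)
definition grad :: "('a::real_inner \<Rightarrow> real) \<Rightarrow> 'a \<Rightarrow> 'a" where
  "grad f x = (THE D. GDERIV f x :> D)"

lemma grad_eqI:
  assumes "GDERIV f x :> D"
  shows "grad f x = D"
  unfolding grad_def
proof (rule the_equality)
  show "GDERIV f x :> D" by (fact assms)
next
  fix D' assume "GDERIV f x :> D'"
  then have "(\<lambda>h. inner h D') = (\<lambda>h. inner h D)"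
    using assms has_derivative_unique unfolding gderiv_def by blast
  then have "inner (D' - D) D' = inner (D' - D) D" by metis
  then have "inner (D' - D) (D' - D) = 0" by (simp add: inner_diff_right)
  then show "D' = D" by simp
qed

(* The convention v_(-1) = 0 is the first case of the conditional. *)
definition aegdm_iterates ::
  "('a::real_inner \<Rightarrow> real) \<Rightarrow> 'a \<Rightarrow> real \<Rightarrow> real \<Rightarrow>
    (nat \<Rightarrow> 'a) \<Rightarrow> (nat \<Rightarrow> 'a) \<Rightarrow> (nat \<Rightarrow> real) \<Rightarrow> bool" where
  "aegdm_iterates F \<theta>0 \<eta> \<beta> \<theta> v r \<longleftrightarrow>
    \<theta> 0 = \<theta>0 \<and>
    r 0 = F \<theta>0 \<and>
    (\<forall>k. v k = \<beta> *\<^sub>R (if k = 0 then 0 else v (k - 1)) + (1 - \<beta>) *\<^sub>R grad F (\<theta> k)) \<and>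
    (\<forall>k. r (Suc k) = r k / (1 + 2 * \<eta> * (norm (v k))\<^sup>2)) \<and>
    (\<forall>k. \<theta> (Suc k) = \<theta> k - (2 * \<eta> * r (Suc k)) *\<^sub>R v k)"

(* The equations hold for t > 0 only; continuity on [0, \<infinity>) is what ties
   the solution to its initial data. *)
definition aegdm_flow ::
  "('a::real_inner \<Rightarrow> real) \<Rightarrow> 'a \<Rightarrow> real \<Rightarrow>
    (real \<Rightarrow> 'a) \<Rightarrow> (real \<Rightarrow> 'a) \<Rightarrow> (real \<Rightarrow> real) \<Rightarrow> bool" where
  "aegdm_flow F \<theta>0 \<epsilon> \<theta> v r \<longleftrightarrow>
    continuous_on {0..} \<theta> \<and> continuous_on {0..} v \<and> continuous_on {0..} r \<and>
    \<theta> 0 = \<theta>0 \<and> v 0 = 0 \<and> r 0 = F \<theta>0 \<and>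
    (\<forall>t>0. \<theta> differentiable (at t) \<and> v differentiable (at t) \<and> r differentiable (at t) \<and>
      \<epsilon> *\<^sub>R vector_derivative v (at t) = - v t + grad F (\<theta> t) \<and>
      vector_derivative r (at t) = - 2 * r t * (norm (v t))\<^sup>2 \<and>
      vector_derivative \<theta> (at t) = - (2 * r t) *\<^sub>R v t)"

(* Pairs (\<eta>, k) with \<eta> \<rightarrow> 0+ along step sizes for which k * \<eta> = T. *)
definition step_filter :: "real \<Rightarrow> (real \<times> nat) filter" where
  "step_filter T =
    inf (filtercomap fst (at_right 0)) (principal {(\<eta>, k). real k * \<eta> = T})"

lemma eventually_step_filter:
  "eventually P (step_filter T) \<longleftrightarrow>
    (\<exists>d>0. \<forall>\<eta> k. 0 < \<eta> \<longrightarrow> \<eta> < d \<longrightarrow> real k * \<eta> = T \<longrightarrow> P (\<eta>, k))"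
proof -
  have "eventually P (step_filter T) \<longleftrightarrow>
    (\<exists>Q. (\<exists>d>0. \<forall>y>0. y < d \<longrightarrow> Q y) \<and>
      (\<forall>x. Q (fst x) \<longrightarrow> x \<in> {(\<eta>, k). real k * \<eta> = T} \<longrightarrow> P x))"
    unfolding step_filter_def eventually_inf_principal eventually_filtercomap
      eventually_at_right_field ..
  also have "\<dots> \<longleftrightarrow>
    (\<exists>d>0. \<forall>\<eta> k. 0 < \<eta> \<longrightarrow> \<eta> < d \<longrightarrow> real k * \<eta> = T \<longrightarrow> P (\<eta>, k))" (is "?L \<longleftrightarrow> ?R")
  proof
    assume ?L
    then show ?R by (elim exE conjE, intro exI conjI) auto
  next
    assume ?R
    then obtain d where "d > 0"
      and d: "\<And>\<eta> k. 0 < \<eta> \<Longrightarrow> \<eta> < d \<Longrightarrow> real k * \<eta> = T \<Longrightarrow> P (\<eta>, k)" by blast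
    then show ?L
      by (intro exI[of _ "\<lambda>\<eta>. 0 < \<eta> \<and> \<eta> < d"]) auto
  qed
  finally show ?thesis .
qed

lemma step_filter_neq_bot:
  assumes "T > 0"
  shows "step_filter T \<noteq> bot"
proof
  assume "step_filter T = bot"
  then have "eventually (\<lambda>_. False) (step_filter T)" by simp
  then obtain d where "d > 0" and d: "\<And>\<eta> k. 0 < \<eta> \<Longrightarrow> \<eta> < d \<Longrightarrow> real k * \<eta> \<noteq> T"
    unfolding eventually_step_filter by blast
  obtain k :: nat where k: "T / d < real k" using reals_Archimedean2 by blast
  with assms \<open>d > 0\<close> have "real k > 0" by (smt (verit) divide_pos_pos)
  with d[of "T / real k" k] assms k \<open>d > 0\<close> show False
    by (simp add: field_simps)
qed

end

theory Submission
  imports Defs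
begin

text \<open>
  Shifting the velocity by one index, the triple \<open>(\<theta>\<^sub>k, v\<^sub>k\<^sub>-\<^sub>1, r\<^sub>k)\<close> starts at the initial
  value of the flow, since \<open>v\<^sub>-\<^sub>1 = 0\<close>. The relation \<open>\<epsilon> = \<beta> \<eta> / (1 - \<beta>)\<close> is equivalent to
  \<open>1 - \<beta> = \<eta> / (\<epsilon> + \<eta>)\<close>, so the velocity update reads
  \<open>v\<^sub>k = v\<^sub>k\<^sub>-\<^sub>1 + \<eta> / (\<epsilon> + \<eta>) (\<nabla>F(\<theta>\<^sub>k) - v\<^sub>k\<^sub>-\<^sub>1)\<close>. Thus the shifted triples are produced by an
  explicit one-step method \<open>w\<^sub>k\<^sub>+\<^sub>1 = w\<^sub>k + \<eta> \<Phi> \<eta> w\<^sub>k\<close> whose increment \<open>\<Phi>\<close> extends continuously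
  to \<open>\<eta> = 0\<close>, and \<open>\<Phi> 0\<close> is the vector field of the flow.

  For such a method convergence is a matter of consistency and stability
  (\<open>one_step_method_converges\<close>). Consistency on compact sets is uniform continuity of \<open>\<Phi>\<close>;
  stability needs a Lipschitz constant for \<open>\<Phi> 0\<close> only on a bounded neighbourhood of the given
  trajectory, because the error estimate itself keeps the iterates in that neighbourhood. The
  vector field is Lipschitz on bounded sets because \<open>\<nabla>F = \<nabla>f / (2 F)\<close>, where \<open>\<nabla>f\<close> and \<open>F\<close> are
  continuously differentiable and \<open>F\<close> is bounded away from zero
  (\<open>lipschitz_on_bounded_grad_sqrt\<close>); all else is polynomial.

  The shift is undone at the end: \<open>v\<^sub>k\<close> is a continuous function of \<open>\<eta>\<close> and the shifted triple,
  and at \<open>\<eta> = 0\<close> it is the projection to the velocity.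
\<close>

section \<open>Maps that are Lipschitz on bounded sets\<close>

definition lipschitz_on_bounded :: "('a::metric_space \<Rightarrow> 'b::metric_space) \<Rightarrow> bool" where
  "lipschitz_on_bounded f \<longleftrightarrow> (\<forall>S. bounded S \<longrightarrow> (\<exists>L. L-lipschitz_on S f))"

lemma lipschitz_on_boundedD:
  assumes "lipschitz_on_bounded f" and "bounded S"
  obtains L where "L-lipschitz_on S f"
  using assms unfolding lipschitz_on_bounded_def by blast

lemma lipschitz_on_bounded_image:
  assumes "lipschitz_on_bounded f" and "bounded S"
  shows "bounded (f ` S)"
proof -
  obtain L where L: "L-lipschitz_on S f" using assms by (rule lipschitz_on_boundedD)
  show ?thesis
  proof (cases "S = {}")
    case False
    then obtain a where a: "a \<in> S" by blast
    obtain B where B: "\<And>y. y \<in> S \<Longrightarrow> dist a y \<le> B"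
      using assms(2) unfolding bounded_any_center[of S a] by blast
    have "dist (f a) (f y) \<le> L * B" if "y \<in> S" for y
    proof -
      have "dist (f a) (f y) \<le> L * dist a y" using lipschitz_onD[OF L a that] .
      also have "\<dots> \<le> L * B" using B[OF that] lipschitz_on_nonneg[OF L] by (rule mult_left_mono)
      finally show ?thesis .
    qed
    then show ?thesis unfolding bounded_def by blast
  qed simp
qed

lemma lipschitz_on_bounded_imp_continuous_on:
  fixes f :: "'a::metric_space \<Rightarrow> 'b::metric_space"
  assumes "lipschitz_on_bounded f"
  shows "continuous_on A f"
proof -
  have "continuous (at x) f" for x
  proof -
    obtain L where "L-lipschitz_on (ball x 1) f"
      using assms bounded_ball by (rule lipschitz_on_boundedD)
    then have "continuous_on (ball x 1) f" by (rule lipschitz_on_continuous_on)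
    then show ?thesis by (simp add: continuous_on_eq_continuous_at)
  qed
  then show ?thesis by (simp add: continuous_at_imp_continuous_on)
qed

named_theorems lipschitz_on_bounded_intros

lemma lipschitz_on_bounded_compose:
  fixes f :: "'a::metric_space \<Rightarrow> 'b::metric_space" and g :: "'b \<Rightarrow> 'c::metric_space"
  assumes "lipschitz_on_bounded g" and "lipschitz_on_bounded f"
  shows "lipschitz_on_bounded (\<lambda>x. g (f x))"
  unfolding lipschitz_on_bounded_def
proof (intro allI impI)
  fix S :: "'a set" assume S: "bounded S"
  obtain C where C: "C-lipschitz_on S f" using assms(2) S by (rule lipschitz_on_boundedD)
  obtain D where D: "D-lipschitz_on (f ` S) g"
    using assms(1) lipschitz_on_bounded_image[OF assms(2) S] by (rule lipschitz_on_boundedD)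
  show "\<exists>L. L-lipschitz_on S (\<lambda>x. g (f x))" using lipschitz_on_compose2[OF C D] by blast
qed

lemma lipschitz_on_bounded_linear:
  assumes "bounded_linear f"
  shows "lipschitz_on_bounded f"
  using bounded_linear.lipschitz_boundE[OF assms] unfolding lipschitz_on_bounded_def by metis

lemma lipschitz_on_bounded_const [lipschitz_on_bounded_intros]: "lipschitz_on_bounded (\<lambda>x. c)"
  using lipschitz_on_constant unfolding lipschitz_on_bounded_def by blast

lemma lipschitz_on_bounded_Pair [lipschitz_on_bounded_intros]:
  assumes "lipschitz_on_bounded f" and "lipschitz_on_bounded g"
  shows "lipschitz_on_bounded (\<lambda>x. (f x, g x))"
  using assms unfolding lipschitz_on_bounded_def by (blast intro: lipschitz_on_Pair)

lemma lipschitz_on_bounded_diff [lipschitz_on_bounded_intros]: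
  fixes f g :: "'a::metric_space \<Rightarrow> 'b::real_normed_vector"
  assumes "lipschitz_on_bounded f" and "lipschitz_on_bounded g"
  shows "lipschitz_on_bounded (\<lambda>x. f x - g x)"
  using assms unfolding lipschitz_on_bounded_def by (blast intro: lipschitz_on_diff)

lemma lipschitz_on_bounded_bilinear:
  fixes f :: "'a::metric_space \<Rightarrow> 'b::real_normed_vector"
    and g :: "'a \<Rightarrow> 'c::real_normed_vector"
    and prod :: "'b \<Rightarrow> 'c \<Rightarrow> 'd::real_normed_vector"
  assumes "bounded_bilinear prod"
    and f: "lipschitz_on_bounded f" and g: "lipschitz_on_bounded g"
  shows "lipschitz_on_bounded (\<lambda>x. prod (f x) (g x))"
  unfolding lipschitz_on_bounded_def
proof (intro allI impI)
  interpret bounded_bilinear prod by fact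
  obtain K where K: "K > 0" "\<And>a b. norm (prod a b) \<le> norm a * norm b * K"
    using pos_bounded by blast
  fix S :: "'a set" assume S: "bounded S"
  obtain C where C: "C-lipschitz_on S f" using f S by (rule lipschitz_on_boundedD)
  obtain D where D: "D-lipschitz_on S g" using g S by (rule lipschitz_on_boundedD)
  obtain A where A: "A > 0" "\<And>x. x \<in> S \<Longrightarrow> norm (f x) \<le> A"
    using lipschitz_on_bounded_image[OF f S] unfolding bounded_pos by blast
  obtain B where B: "B > 0" "\<And>x. x \<in> S \<Longrightarrow> norm (g x) \<le> B"
    using lipschitz_on_bounded_image[OF g S] unfolding bounded_pos by blast
  have C0: "C \<ge> 0" and D0: "D \<ge> 0" using C D lipschitz_on_nonneg by blast+
  have "(K * (C * B + A * D))-lipschitz_on S (\<lambda>x. prod (f x) (g x))"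
  proof (rule lipschitz_onI)
    fix x y assume x: "x \<in> S" and y: "y \<in> S"
    have "prod (f x) (g x) - prod (f y) (g y) = prod (f x - f y) (g x) + prod (f y) (g x - g y)"
      by (simp add: diff_left diff_right)
    then have "norm (prod (f x) (g x) - prod (f y) (g y))
        \<le> norm (f x - f y) * norm (g x) * K + norm (f y) * norm (g x - g y) * K"
      using norm_triangle_mono[OF K(2) K(2)] by simp
    also have "\<dots> \<le> (C * dist x y) * B * K + A * (D * dist x y) * K"
      using A B K C0 D0 lipschitz_onD[OF C x y] lipschitz_onD[OF D x y] x y
      unfolding dist_norm[of "f x"] dist_norm[of "g x"] by (intro add_mono mult_right_mono mult_mono) auto
    finally show "dist (prod (f x) (g x)) (prod (f y) (g y)) \<le> K * (C * B + A * D) * dist x y"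
      by (simp add: dist_norm algebra_simps)
  qed (use A B C0 D0 K in auto)
  then show "\<exists>L. L-lipschitz_on S (\<lambda>x. prod (f x) (g x))" by blast
qed

lemmas lipschitz_on_bounded_fst [lipschitz_on_bounded_intros] =
  lipschitz_on_bounded_compose[OF lipschitz_on_bounded_linear[OF bounded_linear_fst]]
lemmas lipschitz_on_bounded_snd [lipschitz_on_bounded_intros] =
  lipschitz_on_bounded_compose[OF lipschitz_on_bounded_linear[OF bounded_linear_snd]]
lemmas lipschitz_on_bounded_scaleR [lipschitz_on_bounded_intros] =
  lipschitz_on_bounded_bilinear[OF bounded_bilinear_scaleR]
lemmas lipschitz_on_bounded_mult [lipschitz_on_bounded_intros] =
  lipschitz_on_bounded_bilinear[OF bounded_bilinear_mult]
lemmas lipschitz_on_bounded_inner [lipschitz_on_bounded_intros] =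
  lipschitz_on_bounded_bilinear[OF bounded_bilinear_inner]

lemma lipschitz_on_bounded_id [lipschitz_on_bounded_intros]: "lipschitz_on_bounded (\<lambda>x. x)"
  using lipschitz_on_id unfolding lipschitz_on_bounded_def by blast

text \<open>A bounded set lies in a ball, which is convex, and on its compact closure the derivative is
  bounded; the mean value inequality does the rest.\<close>

lemma lipschitz_on_bounded_C1:
  fixes f :: "'a::euclidean_space \<Rightarrow> 'b::real_normed_vector" and f' :: "'a \<Rightarrow> 'a \<Rightarrow>\<^sub>L 'b"
  assumes deriv: "\<And>x. (f has_derivative blinfun_apply (f' x)) (at x)"
    and cont: "continuous_on UNIV f'"
  shows "lipschitz_on_bounded f"
  unfolding lipschitz_on_bounded_def
proof (intro allI impI)
  fix S :: "'a set" assume "bounded S"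
  then obtain M where "\<And>x. x \<in> S \<Longrightarrow> norm x \<le> M" unfolding bounded_iff by blast
  then have M: "S \<subseteq> cball 0 M" by auto
  have "bounded (f' ` cball 0 M)"
    by (intro compact_imp_bounded compact_continuous_image continuous_on_subset[OF cont]) simp_all
  then obtain C where C: "C > 0" "\<And>x. x \<in> cball 0 M \<Longrightarrow> norm (f' x) \<le> C"
    unfolding bounded_pos by blast
  have "C-lipschitz_on (cball 0 M) f"
  proof (rule bounded_derivative_imp_lipschitz)
    show "(f has_derivative blinfun_apply (f' x)) (at x within cball 0 M)" for x
      using deriv by (rule has_derivative_at_withinI)
    show "onorm (blinfun_apply (f' x)) \<le> C" if "x \<in> cball 0 M" for x
      using C(2)[OF that] by (simp add: norm_blinfun.rep_eq)
  qed (use C in auto)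
  then have "C-lipschitz_on S f" using M by (rule lipschitz_on_subset)
  then show "\<exists>L. L-lipschitz_on S f" ..
qed


section \<open>The gradient of the square root\<close>

text \<open>The vector that represents a functional depends linearly on it. This transfers regularity of
  a derivative with values in \<^typ>\<open>'a \<Rightarrow>\<^sub>L real\<close> to the gradient.\<close>

definition riesz :: "('a::euclidean_space \<Rightarrow>\<^sub>L real) \<Rightarrow> 'a" where
  "riesz A = (\<Sum>b\<in>Basis. blinfun_apply A b *\<^sub>R b)"

lemma inner_riesz: "inner h (riesz A) = blinfun_apply A h"
proof -
  have "blinfun_apply A h = blinfun_apply A (\<Sum>b\<in>Basis. inner h b *\<^sub>R b)"
    by (simp only: euclidean_representation)
  also have "\<dots> = inner h (riesz A)"
    by (simp add: riesz_def blinfun.sum_right blinfun.scaleR_right inner_sum_right mult.commute)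
  finally show ?thesis ..
qed

lemma bounded_linear_riesz: "bounded_linear (riesz :: ('a::euclidean_space \<Rightarrow>\<^sub>L real) \<Rightarrow> 'a)"
  unfolding riesz_def
  by (intro bounded_linear_sum bounded_linear_scaleR_const blinfun.bounded_linear_left)

lemma GDERIV_riesz:
  assumes "(f has_derivative blinfun_apply A) (at x)"
  shows "GDERIV f x :> riesz A"
  using assms by (simp add: gderiv_def inner_riesz)

lemma lipschitz_on_bounded_inverse:
  fixes g :: "'a::metric_space \<Rightarrow> real"
  assumes g: "lipschitz_on_bounded g" and m: "m > 0" and ge: "\<And>x. g x \<ge> m"
  shows "lipschitz_on_bounded (\<lambda>x. inverse (g x))"
  unfolding lipschitz_on_bounded_def
proof (intro allI impI)
  fix S :: "'a set" assume S: "bounded S"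
  obtain C where C: "C-lipschitz_on S g" using g S by (rule lipschitz_on_boundedD)
  have "(C / (m * m))-lipschitz_on S (\<lambda>x. inverse (g x))"
  proof (rule lipschitz_onI)
    fix x y assume x: "x \<in> S" and y: "y \<in> S"
    have pos: "g x > 0" "g y > 0" using ge m by (meson less_le_trans)+
    have "dist (inverse (g x)) (inverse (g y)) = dist (g x) (g y) / (g x * g y)"
      using pos by (simp add: dist_real_def field_simps abs_if)
    also have "\<dots> \<le> (C * dist x y) / (m * m)"
      using lipschitz_onD[OF C x y] lipschitz_on_nonneg[OF C] m ge[of x] ge[of y]
      by (intro frac_le mult_mono) auto
    finally show "dist (inverse (g x)) (inverse (g y)) \<le> C / (m * m) * dist x y" by simp
  qed (use lipschitz_on_nonneg[OF C] m in auto)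
  then show "\<exists>L. L-lipschitz_on S (\<lambda>x. inverse (g x))" by blast
qed

text \<open>By the chain rule the gradient is \<open>\<nabla>f / (2 F)\<close> with \<open>F = sqrt (f + c)\<close>, a product of factors that
  are Lipschitz on bounded sets: \<open>\<nabla>f\<close> and \<open>F\<close> are \<open>C\<^sup>1\<close>, and inversion is Lipschitz on \<open>{sqrt m..}\<close>.\<close>

lemma lipschitz_on_bounded_grad_sqrt:
  fixes f :: "'a::euclidean_space \<Rightarrow> real"
  assumes "C2 f" and m: "m > 0" and ge: "\<And>x. f x + c \<ge> m"
  shows "lipschitz_on_bounded (grad (\<lambda>x. sqrt (f x + c)))"
proof -
  let ?F = "\<lambda>x. sqrt (f x + c)"
  obtain f' :: "'a \<Rightarrow> 'a \<Rightarrow>\<^sub>L real" and f'' :: "'a \<Rightarrow> 'a \<Rightarrow>\<^sub>L ('a \<Rightarrow>\<^sub>L real)"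
    where f': "\<And>x. (f has_derivative blinfun_apply (f' x)) (at x)"
      and f'': "\<And>x. (f' has_derivative blinfun_apply (f'' x)) (at x)"
      and cf'': "continuous_on UNIV f''"
    using \<open>C2 f\<close> unfolding C2_def by blast
  have lf': "lipschitz_on_bounded f'" using f'' cf'' by (rule lipschitz_on_bounded_C1)
  have cf': "continuous_on UNIV f'" using lf' by (rule lipschitz_on_bounded_imp_continuous_on)
  have cf: "continuous_on UNIV f"
    by (rule lipschitz_on_bounded_imp_continuous_on[OF lipschitz_on_bounded_C1[OF f' cf']])
  have pos: "f x + c > 0" for x using ge[of x] m by linarith
  let ?F' = "\<lambda>x. inverse (2 * ?F x) *\<^sub>R f' x"
  have F': "(?F has_derivative blinfun_apply (?F' x)) (at x)" for x
  proof -
    have "((\<lambda>x. f x + c) has_derivative blinfun_apply (f' x)) (at x)"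
      using f' by (simp add: has_derivative_add_const)
    from has_derivative_real_sqrt[OF pos this]
    show ?thesis by (rule has_derivative_eq_rhs) (simp add: blinfun.scaleR_left fun_eq_iff field_simps)
  qed
  have "continuous_on UNIV ?F'"
    using pos by (intro continuous_intros cf cf') (auto simp: less_imp_neq[symmetric])
  with F' have lF: "lipschitz_on_bounded ?F" by (rule lipschitz_on_bounded_C1)
  have "grad ?F = (\<lambda>x. riesz (?F' x))"
    using F' by (intro ext grad_eqI GDERIV_riesz)
  moreover have "lipschitz_on_bounded (\<lambda>x. inverse (2 * ?F x))"
    using m ge
    by (intro lipschitz_on_bounded_inverse[where m = "2 * sqrt m"] lipschitz_on_bounded_intros lF) auto
  ultimately show ?thesis
    by (simp only:) (intro lf' lipschitz_on_bounded_scaleR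
        lipschitz_on_bounded_compose[OF lipschitz_on_bounded_linear[OF bounded_linear_riesz]])
qed


section \<open>Convergence of one-step methods\<close>

text \<open>This bounds the local error of an Euler step with direction \<open>d\<close> that starts on the curve: the
  map \<open>t \<mapsto> u t - t d\<close> has derivative \<open>u' t - d\<close>, to which the mean value inequality applies.\<close>

lemma euler_step_error:
  fixes u :: "real \<Rightarrow> 'a::real_normed_vector"
  assumes "a < b" and "continuous_on {a..b} u"
    and u': "\<And>t. a < t \<Longrightarrow> t < b \<Longrightarrow> (u has_vector_derivative u' t) (at t)"
    and bound: "\<And>t. a < t \<Longrightarrow> t < b \<Longrightarrow> norm (u' t - d) \<le> \<delta>"
  shows "norm (u b - u a - (b - a) *\<^sub>R d) \<le> (b - a) * \<delta>"
proof -
  have "norm ((u b - b *\<^sub>R d) - (u a - a *\<^sub>R d)) \<le> \<delta> * b - \<delta> * a"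
  proof (rule differentiable_bound_general[OF \<open>a < b\<close>])
    show "continuous_on {a..b} (\<lambda>t. u t - t *\<^sub>R d)"
      using assms(2) by (intro continuous_intros)
    show "continuous_on {a..b} (\<lambda>t. \<delta> * t)" by (intro continuous_intros)
    show "((\<lambda>t. u t - t *\<^sub>R d) has_vector_derivative u' t - d) (at t)" if "a < t" "t < b" for t
      by (auto intro!: derivative_eq_intros u' that)
    show "((\<lambda>t. \<delta> * t) has_vector_derivative \<delta>) (at t)" for t
      by (auto intro!: derivative_eq_intros)
  qed (use bound in auto)
  then show ?thesis by (simp add: algebra_simps)
qed

text \<open>The errors \<open>e\<^sub>j\<close> obey \<open>e\<^sub>j\<^sub>+\<^sub>1 \<le> (1 + L \<eta>) e\<^sub>j + 2 \<delta> \<eta>\<close>, where one \<open>\<delta>\<close> bounds the difference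
  between \<open>\<Phi> \<eta>\<close> and \<open>\<Phi> 0\<close> and the other the oscillation of \<open>\<Phi> 0\<close> along the trajectory during a
  step. Hence \<open>e\<^sub>j \<le> 2 \<delta> j \<eta> exp (L j \<eta>)\<close>. By the choice of \<open>\<delta>\<close> this is at most one for \<open>j \<eta> \<le> T\<close>,
  and this keeps \<open>w\<^sub>j\<close> in the ball on which the estimates for the next step hold: the ball is larger
  by one than a ball around the origin that contains the trajectory.\<close>

theorem one_step_method_converges:
  fixes \<Phi> :: "real \<Rightarrow> 'a::euclidean_space \<Rightarrow> 'a"
  assumes cont: "continuous_on ({0..} \<times> UNIV) (\<lambda>(\<eta>, x). \<Phi> \<eta> x)"
    and lip: "lipschitz_on_bounded (\<Phi> 0)"
    and u_cont: "continuous_on {0..T} u"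
    and u': "\<And>t. 0 < t \<Longrightarrow> t < T \<Longrightarrow> (u has_vector_derivative \<Phi> 0 (u t)) (at t)"
    and w0: "\<And>\<eta>. \<eta> > 0 \<Longrightarrow> w \<eta> 0 = u 0"
    and w_Suc: "\<And>\<eta> k. \<eta> > 0 \<Longrightarrow> w \<eta> (Suc k) = w \<eta> k + \<eta> *\<^sub>R \<Phi> \<eta> (w \<eta> k)"
    and "T > 0"
  shows "((\<lambda>(\<eta>, k). w \<eta> k) \<longlongrightarrow> u T) (step_filter T)"
proof (rule tendstoI)
  fix e :: real assume "e > 0"
  have "bounded (u ` {0..T})"
    by (intro compact_imp_bounded compact_continuous_image u_cont compact_Icc)
  then obtain M0 where M0: "\<And>t. t \<in> {0..T} \<Longrightarrow> norm (u t) \<le> M0"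
    unfolding bounded_iff by blast
  define M where "M = M0 + 1"
  obtain L where L: "L-lipschitz_on (cball 0 M) (\<Phi> 0)"
    using lip bounded_cball by (rule lipschitz_on_boundedD)
  have L0: "L \<ge> 0" using L by (rule lipschitz_on_nonneg)
  have u_M: "u t \<in> cball 0 M" if "t \<in> {0..T}" for t using M0[OF that] by (simp add: M_def)
  define e' where "e' = min e 1"
  have e': "0 < e'" "e' \<le> e" "e' \<le> 1" using \<open>e > 0\<close> by (auto simp: e'_def)
  \<comment> \<open>This makes the error bound at time \<open>T\<close> equal to \<open>e' / 2\<close>, below both the target \<open>e\<close> and one.\<close>
  define \<delta> where "\<delta> = e' / (4 * T * exp (L * T))"
  have \<delta>: "\<delta> > 0" using e' \<open>T > 0\<close> by (simp add: \<delta>_def)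
  have bound_e': "2 * \<delta> * T * exp (L * T) = e' / 2" using \<open>T > 0\<close> by (simp add: \<delta>_def)

  have "uniformly_continuous_on ({0..1} \<times> cball 0 M) (\<lambda>(\<eta>, x). \<Phi> \<eta> x)"
    by (intro compact_uniformly_continuous compact_Times continuous_on_subset[OF cont]) auto
  then obtain d1 where d1: "d1 > 0"
    "\<And>p q. p \<in> {0..1} \<times> cball 0 M \<Longrightarrow> q \<in> {0..1} \<times> cball 0 M \<Longrightarrow> dist q p < d1 \<Longrightarrow>
       dist (case q of (\<eta>, x) \<Rightarrow> \<Phi> \<eta> x) (case p of (\<eta>, x) \<Rightarrow> \<Phi> \<eta> x) < \<delta>"
    using \<delta> unfolding uniformly_continuous_on_def by metis
  have consistent: "norm (\<Phi> \<eta> x - \<Phi> 0 x) \<le> \<delta>" if "0 < \<eta>" "\<eta> < d1" "\<eta> \<le> 1" "x \<in> cball 0 M" for \<eta> x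
    using d1(2)[of "(0, x)" "(\<eta>, x)"] that by (auto simp: dist_Pair_Pair dist_norm)

  have "continuous_on {0..T} (\<lambda>t. \<Phi> 0 (u t))"
    by (rule continuous_on_compose2[OF lipschitz_on_bounded_imp_continuous_on[OF lip] u_cont]) auto
  then have "uniformly_continuous_on {0..T} (\<lambda>t. \<Phi> 0 (u t))"
    by (rule compact_uniformly_continuous) simp
  then obtain d2 where d2: "d2 > 0"
    "\<And>s t. s \<in> {0..T} \<Longrightarrow> t \<in> {0..T} \<Longrightarrow> dist t s < d2 \<Longrightarrow> dist (\<Phi> 0 (u t)) (\<Phi> 0 (u s)) < \<delta>"
    using \<delta> unfolding uniformly_continuous_on_def by metis

  have "dist (w \<eta> k) (u T) < e"
    if \<eta>: "0 < \<eta>" "\<eta> < min d1 (min d2 1)" and k: "real k * \<eta> = T" for \<eta> k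
  proof -
    have err: "norm (w \<eta> j - u (j * \<eta>)) \<le> 2 * \<delta> * (j * \<eta>) * exp (L * (j * \<eta>))" if "j \<le> k" for j
      using that
    proof (induction j)
      case 0
      then show ?case using w0 \<eta> by simp
    next
      case (Suc j)
      let ?a = "j * \<eta>" and ?b = "Suc j * \<eta>"
      have ab: "0 \<le> ?a" "?a < ?b" "?b \<le> T" "?b - ?a = \<eta>"
        using \<eta> Suc.prems k mult_right_mono[of "real (Suc j)" "real k" \<eta>] by (auto simp: algebra_simps)
      have IH: "norm (w \<eta> j - u ?a) \<le> 2 * \<delta> * ?a * exp (L * ?a)"
        using Suc by simp
      also have "\<dots> \<le> 2 * \<delta> * T * exp (L * T)"
        using ab \<delta> L0 \<open>T > 0\<close> by (intro mult_mono) (auto intro: mult_left_mono)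
      also have "\<dots> \<le> 1" unfolding bound_e' using e' by simp
      finally have "norm (w \<eta> j - u ?a) \<le> 1" .
      moreover have "norm (u ?a) \<le> M0" using M0 ab by simp
      ultimately have w_M: "w \<eta> j \<in> cball 0 M"
        using norm_triangle_sub[of "w \<eta> j" "u ?a"] by (simp add: M_def)
      have step: "norm (u ?b - u ?a - (?b - ?a) *\<^sub>R \<Phi> 0 (u ?a)) \<le> (?b - ?a) * \<delta>"
      proof (rule euler_step_error[where u' = "\<lambda>t. \<Phi> 0 (u t)"])
        show "continuous_on {?a..?b} u" using ab by (intro continuous_on_subset[OF u_cont]) auto
        show "(u has_vector_derivative \<Phi> 0 (u t)) (at t)" if "?a < t" "t < ?b" for t
          using that ab by (intro u') linarith+
        show "norm (\<Phi> 0 (u t) - \<Phi> 0 (u ?a)) \<le> \<delta>" if "?a < t" "t < ?b" for t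
          using d2(2)[of ?a t] that ab \<eta> by (auto simp: dist_norm)
      qed (use ab in auto)
      have "w \<eta> (Suc j) - u ?b = (w \<eta> j - u ?a) + \<eta> *\<^sub>R (\<Phi> \<eta> (w \<eta> j) - \<Phi> 0 (w \<eta> j))
          + \<eta> *\<^sub>R (\<Phi> 0 (w \<eta> j) - \<Phi> 0 (u ?a)) - (u ?b - u ?a - \<eta> *\<^sub>R \<Phi> 0 (u ?a))"
        using \<eta> by (simp add: w_Suc scaleR_diff_right)
      then have "norm (w \<eta> (Suc j) - u ?b) \<le> norm (w \<eta> j - u ?a)
          + norm (\<eta> *\<^sub>R (\<Phi> \<eta> (w \<eta> j) - \<Phi> 0 (w \<eta> j)))
          + norm (\<eta> *\<^sub>R (\<Phi> 0 (w \<eta> j) - \<Phi> 0 (u ?a)))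
          + norm (u ?b - u ?a - \<eta> *\<^sub>R \<Phi> 0 (u ?a))"
        by (metis (no_types, lifting) norm_triangle_le norm_triangle_le_diff order_refl add_mono)
      also have "\<dots> \<le> norm (w \<eta> j - u ?a) + \<eta> * \<delta> + \<eta> * (L * norm (w \<eta> j - u ?a)) + \<eta> * \<delta>"
      proof (intro add_mono order_refl)
        show "norm (\<eta> *\<^sub>R (\<Phi> \<eta> (w \<eta> j) - \<Phi> 0 (w \<eta> j))) \<le> \<eta> * \<delta>"
          using consistent[OF _ _ _ w_M] \<eta> by simp
        show "norm (\<eta> *\<^sub>R (\<Phi> 0 (w \<eta> j) - \<Phi> 0 (u ?a))) \<le> \<eta> * (L * norm (w \<eta> j - u ?a))"
          using lipschitz_on_normD[OF L w_M u_M[of ?a]] ab \<eta> by simp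
        show "norm (u ?b - u ?a - \<eta> *\<^sub>R \<Phi> 0 (u ?a)) \<le> \<eta> * \<delta>" using step ab(4) by simp
      qed
      also have "\<dots> = (1 + L * \<eta>) * norm (w \<eta> j - u ?a) + 2 * \<delta> * \<eta>"
        by (simp add: algebra_simps)
      also have "\<dots> \<le> exp (L * \<eta>) * (2 * \<delta> * ?a * exp (L * ?a)) + 2 * \<delta> * \<eta> * exp (L * ?b)"
      proof (rule add_mono[OF mult_mono[OF exp_ge_add_one_self IH]])
        have "1 \<le> exp (L * ?b)" using L0 ab by simp
        then show "2 * \<delta> * \<eta> \<le> 2 * \<delta> * \<eta> * exp (L * ?b)"
          using \<delta> \<eta> mult_left_mono[of 1 "exp (L * ?b)" "2 * \<delta> * \<eta>"] by simp
      qed auto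
      also have "exp (L * \<eta>) * (2 * \<delta> * ?a * exp (L * ?a)) = 2 * \<delta> * ?a * exp (L * ?b)"
        by (simp add: algebra_simps flip: exp_add)
      also have "2 * \<delta> * ?a * exp (L * ?b) + 2 * \<delta> * \<eta> * exp (L * ?b) = 2 * \<delta> * ?b * exp (L * ?b)"
        by (simp add: algebra_simps)
      finally show ?case .
    qed
    show ?thesis using err[of k] bound_e' e' by (simp add: k dist_norm)
  qed
  then show "\<forall>\<^sub>F p in step_filter T. dist (case p of (\<eta>, k) \<Rightarrow> w \<eta> k) (u T) < e"
    unfolding eventually_step_filter using d1(1) d2(1)
    by (intro exI[of _ "min d1 (min d2 1)"]) auto
qed


section \<open>The momentum scheme as a one-step method\<close>

text \<open>The velocity \<open>v\<^sub>k\<close> in terms of \<open>\<theta>\<^sub>k\<close> and \<open>v\<^sub>k\<^sub>-\<^sub>1\<close>.\<close>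

definition velocity_update ::
  "('a::real_inner \<Rightarrow> 'a) \<Rightarrow> real \<Rightarrow> real \<Rightarrow> 'a \<times> 'a \<times> real \<Rightarrow> 'a" where
  "velocity_update g \<epsilon> \<eta> = (\<lambda>(x, v, r). v + (\<eta> / (\<epsilon> + \<eta>)) *\<^sub>R (g x - v))"

text \<open>The difference quotient of one step of the scheme. Dividing by \<open>\<eta>\<close> has been carried out
  symbolically, so that the formula makes sense and is continuous at \<open>\<eta> = 0\<close>.\<close>

definition aegdm_increment ::
  "('a::real_inner \<Rightarrow> 'a) \<Rightarrow> real \<Rightarrow> real \<Rightarrow> 'a \<times> 'a \<times> real \<Rightarrow> 'a \<times> 'a \<times> real" where
  "aegdm_increment g \<epsilon> \<eta> = (\<lambda>(x, v, r).
     let v' = velocity_update g \<epsilon> \<eta> (x, v, r); q = 1 + 2 * \<eta> * inner v' v' in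
       (- (2 * r / q) *\<^sub>R v', (1 / (\<epsilon> + \<eta>)) *\<^sub>R (g x - v), - (2 * r * inner v' v' / q)))"

lemma continuous_on_velocity_update:
  assumes "\<epsilon> > 0" and g: "continuous_on UNIV g"
  shows "continuous_on ({0..} \<times> UNIV) (\<lambda>(\<eta>, p). velocity_update g \<epsilon> \<eta> p)"
  unfolding velocity_update_def case_prod_unfold using \<open>\<epsilon> > 0\<close>
  by (intro continuous_intros continuous_on_compose2[OF g]) auto

lemma continuous_on_aegdm_increment:
  assumes "\<epsilon> > 0" and g: "continuous_on UNIV g"
  shows "continuous_on ({0..} \<times> UNIV) (\<lambda>(\<eta>, p). aegdm_increment g \<epsilon> \<eta> p)"
proof -
  have v: "continuous_on ({0..} \<times> UNIV) (\<lambda>z. velocity_update g \<epsilon> (fst z) (snd z))"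
    using continuous_on_velocity_update[OF assms] by (simp add: case_prod_unfold)
  have q: "1 + 2 * fst z * inner (y z) (y z) \<noteq> 0" if "z \<in> {0..} \<times> UNIV" for z and y :: "_ \<Rightarrow> 'a"
  proof -
    have "0 \<le> fst z * inner (y z) (y z)" using that by auto
    then show ?thesis by linarith
  qed
  show ?thesis
    unfolding aegdm_increment_def case_prod_unfold Let_def prod.collapse using \<open>\<epsilon> > 0\<close>
    by (intro continuous_intros v continuous_on_compose2[OF g] ballI q) auto
qed

lemma aegdm_increment_0:
  "aegdm_increment g \<epsilon> 0 (x, v, r) =
     (- (2 * r) *\<^sub>R v, (1 / \<epsilon>) *\<^sub>R (g x - v), - 2 * r * (norm v)\<^sup>2)"
  by (simp add: aegdm_increment_def velocity_update_def power2_norm_eq_inner)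

lemma lipschitz_on_bounded_aegdm_increment_0:
  assumes "lipschitz_on_bounded g"
  shows "lipschitz_on_bounded (aegdm_increment g \<epsilon> 0)"
proof -
  have "aegdm_increment g \<epsilon> 0 = (\<lambda>p. ((- 2 * snd (snd p)) *\<^sub>R fst (snd p),
      (1 / \<epsilon>) *\<^sub>R (g (fst p) - fst (snd p)), (- 2 * snd (snd p)) * inner (fst (snd p)) (fst (snd p))))"
    by (auto simp: fun_eq_iff aegdm_increment_0 power2_norm_eq_inner)
  then show ?thesis
    by (simp only:) (intro lipschitz_on_bounded_intros lipschitz_on_bounded_compose[OF assms])
qed

lemma aegdm_iterates_step:
  fixes v :: "nat \<Rightarrow> 'a::real_inner"
  assumes it: "aegdm_iterates F \<theta>0 \<eta> \<beta> \<theta> v r"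
    and "\<epsilon> > 0" "\<eta> > 0" "\<beta> < 1" and \<epsilon>: "\<epsilon> = \<beta> * \<eta> / (1 - \<beta>)"
  defines "w \<equiv> \<lambda>k. (\<theta> k, if k = 0 then 0 else v (k - 1), r k)"
  shows "v k = velocity_update (grad F) \<epsilon> \<eta> (w k)"
    and "w (Suc k) = w k + \<eta> *\<^sub>R aegdm_increment (grad F) \<epsilon> \<eta> (w k)"
proof -
  have "\<epsilon> * (1 - \<beta>) = \<beta> * \<eta>" using \<epsilon> \<open>\<beta> < 1\<close> by simp
  then have \<beta>: "1 - \<beta> = \<eta> / (\<epsilon> + \<eta>)"
    using \<open>\<epsilon> > 0\<close> \<open>\<eta> > 0\<close> by (simp add: field_simps)
  define y where "y = (if k = 0 then 0 else v (k - 1))"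
  have "v k = \<beta> *\<^sub>R y + (1 - \<beta>) *\<^sub>R grad F (\<theta> k)"
    using it unfolding aegdm_iterates_def y_def by blast
  also have "\<dots> = y + (1 - \<beta>) *\<^sub>R (grad F (\<theta> k) - y)"
    by (simp add: algebra_simps)
  finally have v: "v k = y + (\<eta> / (\<epsilon> + \<eta>)) *\<^sub>R (grad F (\<theta> k) - y)" unfolding \<beta> .
  then show vk: "v k = velocity_update (grad F) \<epsilon> \<eta> (w k)"
    by (simp add: w_def velocity_update_def y_def)
  define q where "q = 1 + 2 * \<eta> * inner (v k) (v k)"
  have q: "q > 0" using \<open>\<eta> > 0\<close> unfolding q_def by (intro add_pos_nonneg) auto
  have r: "r (Suc k) = r k / q" and \<theta>: "\<theta> (Suc k) = \<theta> k - (2 * \<eta> * r (Suc k)) *\<^sub>R v k"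
    using it unfolding aegdm_iterates_def q_def power2_norm_eq_inner by blast+
  have "r k = r k * q - \<eta> * (2 * r k * inner (v k) (v k))" by (simp add: q_def algebra_simps)
  then have r': "r (Suc k) = r k + \<eta> * - (2 * r k * inner (v k) (v k) / q)"
    using q unfolding r by (simp add: field_simps)
  have \<theta>': "\<theta> (Suc k) = \<theta> k + \<eta> *\<^sub>R - (2 * r k / q) *\<^sub>R v k"
    unfolding \<theta> r by (simp add: ac_simps)
  have v': "v k = y + \<eta> *\<^sub>R (1 / (\<epsilon> + \<eta>)) *\<^sub>R (grad F (\<theta> k) - y)"
    using v by simp
  have w: "w k = (\<theta> k, y, r k)" "w (Suc k) = (\<theta> (Suc k), v k, r (Suc k))"
    by (simp_all add: w_def y_def)
  have "aegdm_increment (grad F) \<epsilon> \<eta> (\<theta> k, y, r k) =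
      (- (2 * r k / q) *\<^sub>R v k, (1 / (\<epsilon> + \<eta>)) *\<^sub>R (grad F (\<theta> k) - y), - (2 * r k * inner (v k) (v k) / q))"
    using vk unfolding w by (simp add: aegdm_increment_def Let_def q_def)
  then show "w (Suc k) = w k + \<eta> *\<^sub>R aegdm_increment (grad F) \<epsilon> \<eta> (w k)"
    by (simp only: w scaleR_Pair add_Pair real_scaleR_def prod.inject) (intro conjI \<theta>' v' r')
qed

lemma aegdm_flow_has_vector_derivative:
  assumes "aegdm_flow F \<theta>0 \<epsilon> \<Theta> V R" and "\<epsilon> > 0" and "t > 0"
  shows "((\<lambda>t. (\<Theta> t, V t, R t)) has_vector_derivative
           aegdm_increment (grad F) \<epsilon> 0 (\<Theta> t, V t, R t)) (at t)"
proof -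
  have \<Theta>: "(\<Theta> has_vector_derivative - (2 * R t) *\<^sub>R V t) (at t)"
    and V: "(V has_vector_derivative vector_derivative V (at t)) (at t)"
    and R: "(R has_vector_derivative - 2 * R t * (norm (V t))\<^sup>2) (at t)"
    and eq: "\<epsilon> *\<^sub>R vector_derivative V (at t) = - V t + grad F (\<Theta> t)"
    using assms unfolding aegdm_flow_def by (metis vector_derivative_works)+
  have "vector_derivative V (at t) = (1 / \<epsilon>) *\<^sub>R (\<epsilon> *\<^sub>R vector_derivative V (at t))"
    using \<open>\<epsilon> > 0\<close> by simp
  also have "\<dots> = (1 / \<epsilon>) *\<^sub>R (grad F (\<Theta> t) - V t)" unfolding eq by simp
  finally show ?thesis
    using has_vector_derivative_Pair[OF \<Theta> has_vector_derivative_Pair[OF V R]]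
    by (simp only: aegdm_increment_0)
qed


section \<open>Convergence to the flow\<close>

theorem theorem4p1:
  fixes f F :: "real ^ 'n \<Rightarrow> real" and c fstar \<epsilon> T :: real and \<theta>0 :: "real ^ 'n"
    and \<beta> :: "real \<Rightarrow> real"
    and \<theta> v :: "real \<Rightarrow> nat \<Rightarrow> real ^ 'n" and r :: "real \<Rightarrow> nat \<Rightarrow> real"
    and \<Theta> V :: "real \<Rightarrow> real ^ 'n" and R :: "real \<Rightarrow> real"
  assumes "C2 f" and "coercive f" and "bdd_below (range f)"
    and "fstar \<in> range f" and "\<And>x. fstar \<le> f x"
    and "\<And>x. F x = sqrt (f x + c)"
    and "\<And>x. F x \<ge> sqrt (fstar + c)" and "sqrt (fstar + c) > 0"
    and "\<epsilon> > 0"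
    and "\<And>\<eta>. \<eta> > 0 \<Longrightarrow> 0 < \<beta> \<eta> \<and> \<beta> \<eta> < 1 \<and> \<epsilon> = \<beta> \<eta> * \<eta> / (1 - \<beta> \<eta>)"
    and "\<And>\<eta>. \<eta> > 0 \<Longrightarrow> aegdm_iterates F \<theta>0 \<eta> (\<beta> \<eta>) (\<theta> \<eta>) (v \<eta>) (r \<eta>)"
    and "aegdm_flow F \<theta>0 \<epsilon> \<Theta> V R"
    and "T > 0"
  shows "((\<lambda>(\<eta>, k). (\<theta> \<eta> k, v \<eta> k, r \<eta> k)) \<longlongrightarrow> (\<Theta> T, V T, R T)) (step_filter T)"
proof -
  let ?g = "grad F"
  define w where "w \<eta> k = (\<theta> \<eta> k, if k = 0 then 0 else v \<eta> (k - 1), r \<eta> k)" for \<eta> k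
  let ?u = "\<lambda>t. (\<Theta> t, V t, R t)"
  have flow0: "\<Theta> 0 = \<theta>0" "V 0 = 0" "R 0 = F \<theta>0"
    and flow_cont: "continuous_on {0..} \<Theta>" "continuous_on {0..} V" "continuous_on {0..} R"
    using assms(12) unfolding aegdm_flow_def by blast+
  have "F = (\<lambda>x. sqrt (f x + c))" using assms(6) by (rule ext)
  then have lip_g: "lipschitz_on_bounded ?g"
    using lipschitz_on_bounded_grad_sqrt[of f "fstar + c" c] assms(1,5,8) by simp
  then have cont_g: "continuous_on UNIV ?g" by (rule lipschitz_on_bounded_imp_continuous_on)

  have v_eq: "v \<eta> k = velocity_update ?g \<epsilon> \<eta> (w \<eta> k)"
    and w_Suc: "w \<eta> (Suc k) = w \<eta> k + \<eta> *\<^sub>R aegdm_increment ?g \<epsilon> \<eta> (w \<eta> k)" if "\<eta> > 0" for \<eta> k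
    using aegdm_iterates_step[OF assms(11)[OF that] assms(9) that, of k] assms(10)[OF that]
    unfolding w_def by blast+
  have w0: "w \<eta> 0 = ?u 0" if "\<eta> > 0" for \<eta>
    using assms(11)[OF that] flow0 by (simp add: w_def aegdm_iterates_def)
  have "continuous_on {0..T} ?u"
    by (intro continuous_on_Pair continuous_on_subset[OF flow_cont(1)]
        continuous_on_subset[OF flow_cont(2)] continuous_on_subset[OF flow_cont(3)]) auto
  then have w_lim: "((\<lambda>(\<eta>, k). w \<eta> k) \<longlongrightarrow> ?u T) (step_filter T)"
    by (intro one_step_method_converges[where \<Phi> = "aegdm_increment ?g \<epsilon>"]
        continuous_on_aegdm_increment lipschitz_on_bounded_aegdm_increment_0
        aegdm_flow_has_vector_derivative[OF assms(12)] assms(9,13) cont_g lip_g w0 w_Suc)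

  \<comment> \<open>At \<open>\<eta> = 0\<close> the velocity update is the identity on \<open>v\<close>, so \<open>v\<^sub>k\<close> and \<open>v\<^sub>k\<^sub>-\<^sub>1\<close> share their limit.\<close>
  have pos: "\<forall>\<^sub>F p in step_filter T. 0 < fst p"
    unfolding eventually_step_filter by (auto intro: exI[of _ 1])
  have "(fst \<longlongrightarrow> 0) (step_filter T)"
    unfolding tendsto_iff eventually_step_filter by (auto simp: dist_real_def)
  with w_lim have "((\<lambda>p. (fst p, w (fst p) (snd p))) \<longlongrightarrow> (0, ?u T)) (step_filter T)"
    by (intro tendsto_Pair) (auto simp: case_prod_unfold)
  with continuous_on_velocity_update[OF assms(9) cont_g]
  have "((\<lambda>p. velocity_update ?g \<epsilon> (fst p) (w (fst p) (snd p)))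
      \<longlongrightarrow> velocity_update ?g \<epsilon> 0 (?u T)) (step_filter T)"
    using pos
    by (auto dest!: continuous_on_tendsto_compose elim: eventually_mono)
  moreover have "\<forall>\<^sub>F p in step_filter T.
      velocity_update ?g \<epsilon> (fst p) (w (fst p) (snd p)) = v (fst p) (snd p)"
    using pos by eventually_elim (simp add: v_eq)
  ultimately have "((\<lambda>p. v (fst p) (snd p)) \<longlongrightarrow> velocity_update ?g \<epsilon> 0 (?u T)) (step_filter T)"
    by (rule Lim_transform_eventually)
  then have v_lim: "((\<lambda>p. v (fst p) (snd p)) \<longlongrightarrow> V T) (step_filter T)"
    by (simp add: velocity_update_def)

  have "((\<lambda>p. \<theta> (fst p) (snd p)) \<longlongrightarrow> \<Theta> T) (step_filter T)"
    and "((\<lambda>p. r (fst p) (snd p)) \<longlongrightarrow> R T) (step_filter T)"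
    using tendsto_fst[OF w_lim] tendsto_snd[OF tendsto_snd[OF w_lim]]
    by (simp_all add: w_def case_prod_unfold)
  with v_lim show ?thesis
    unfolding case_prod_unfold by (intro tendsto_Pair)
qed

end
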